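(* Let $\mathbb F$ be a finite field of odd order and let $Q=Q_{a,b}$ be a quadratic quasigroup upon $\mathbb F$. Then: (i) $Q$ is medial (satisfies $xy\cdot uv=xu\cdot yv$) if and only if $a=b$; (ii) $Q$ is left distributive (satisfies $x\cdot yz=xy\cdot xz$) if and only if $a=b$; (iii) $Q$ is right distributive (satisfies $xy\cdot z=xz\cdot yz$) if and only if $a=b$; (iv) $Q$ is commutative if and only if $a+b=1$ and either $|\mathbb F|\equiv3\pmod 4$ or $a=b$; (v) $Q$ is flexible (satisfies $x\cdot yx=xy\cdot x$) if and only if $a=b$, or $\chi(a)=\chi(1-a)=1$, or both $a+b=1$ and $|\mathbb F|\equiv3\pmod4$; (vi) $Q$ is semisymmetric (satisfies $xy\cdot x=y$) if and only if $a^2-a+1=0$ and either $a=b$ or $a+b=1$; (vii) $Q$ is a Steiner quasigroup (idempotent, commutative and semisymmetric) if and only if either $\operatorname{char}(\mathbb F)=3$ and $a=b=-1$, or $\operatorname{char}(\mathbb F)>3$, $a+b=ab=1$ and $\chi(a)=\chi(-1)=-1$; in the latter case $a\ne b$; (viii) $Q$ is isotopic to a group if and only if $a=b$.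
   Context: $\chi$ is the quadratic character of $\mathbb F$ ($\chi(0)=0$, $1$ on nonzero squares, $-1$ on nonsquares). For $a,b\in\mathbb F$ with $\chi(a)=\chi(b)\ne0$ and $\chi(1-a)=\chi(1-b)\ne0$, $Q_{a,b}$ is $(\mathbb F,* )$ with $x*y=x+a(y-x)$ if $\chi(y-x)\ge0$ and $x*y=x+b(y-x)$ if $\chi(y-x)=-1$. Juxtaposition denotes the operation $*$. *)

theory Defs
  imports "HOL-Algebra.Group" "HOL-Number_Theory.Cong" "HOL-Library.Cardinality"
begin

definition quad_char :: "'a::field \<Rightarrow> int" where
  "quad_char x = (if x = 0 then 0 else if \<exists>y. x = y ^ 2 then 1 else - 1)"

definition quad_qg :: "'a::field \<Rightarrow> 'a \<Rightarrow> 'a \<Rightarrow> 'a \<Rightarrow> 'a" where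
  "quad_qg a b x y =
     (if quad_char (y - x) \<ge> 0 then x + a * (y - x) else x + b * (y - x))"

definition medial :: "('a \<Rightarrow> 'a \<Rightarrow> 'a) \<Rightarrow> bool" where
  "medial f \<longleftrightarrow> (\<forall>x y u v. f (f x y) (f u v) = f (f x u) (f y v))"

definition left_distributive :: "('a \<Rightarrow> 'a \<Rightarrow> 'a) \<Rightarrow> bool" where
  "left_distributive f \<longleftrightarrow> (\<forall>x y z. f x (f y z) = f (f x y) (f x z))"

definition right_distributive :: "('a \<Rightarrow> 'a \<Rightarrow> 'a) \<Rightarrow> bool" where
  "right_distributive f \<longleftrightarrow> (\<forall>x y z. f (f x y) z = f (f x z) (f y z))"

definition commutative_op :: "('a \<Rightarrow> 'a \<Rightarrow> 'a) \<Rightarrow> bool" where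
  "commutative_op f \<longleftrightarrow> (\<forall>x y. f x y = f y x)"

definition flexible :: "('a \<Rightarrow> 'a \<Rightarrow> 'a) \<Rightarrow> bool" where
  "flexible f \<longleftrightarrow> (\<forall>x y. f x (f y x) = f (f x y) x)"

definition semisymmetric :: "('a \<Rightarrow> 'a \<Rightarrow> 'a) \<Rightarrow> bool" where
  "semisymmetric f \<longleftrightarrow> (\<forall>x y. f (f x y) x = y)"

definition idempotent_op :: "('a \<Rightarrow> 'a \<Rightarrow> 'a) \<Rightarrow> bool" where
  "idempotent_op f \<longleftrightarrow> (\<forall>x. f x x = x)"

text \<open>Semisymmetry already makes all translations bijective, so no separate quasigroup
  condition is needed here.\<close>

definition steiner_quasigroup :: "('a \<Rightarrow> 'a \<Rightarrow> 'a) \<Rightarrow> bool" where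
  "steiner_quasigroup f \<longleftrightarrow> idempotent_op f \<and> commutative_op f \<and> semisymmetric f"

definition isotopic_to :: "('a \<Rightarrow> 'a \<Rightarrow> 'a) \<Rightarrow> ('g, 'm) monoid_scheme \<Rightarrow> bool" where
  "isotopic_to f G \<longleftrightarrow>
     (\<exists>\<alpha> \<beta> \<gamma>. bij_betw \<alpha> UNIV (carrier G) \<and> bij_betw \<beta> UNIV (carrier G) \<and>
        bij_betw \<gamma> UNIV (carrier G) \<and> (\<forall>x y. \<alpha> x \<otimes>\<^bsub>G\<^esub> \<beta> y = \<gamma> (f x y)))"

text \<open>Restricting to groups whose elements have type \<^typ>\<open>'a\<close> loses nothing: by the lemma
  below, an isotopy to a group over any other type can be transported.\<close>

definition isotopic_to_group :: "('a \<Rightarrow> 'a \<Rightarrow> 'a) \<Rightarrow> bool" where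
  "isotopic_to_group f \<longleftrightarrow> (\<exists>G :: 'a monoid. group G \<and> isotopic_to f G)"

lemma isotopic_to_groupI:
  fixes f :: "'a \<Rightarrow> 'a \<Rightarrow> 'a" and G :: "('g, 'm) monoid_scheme"
  assumes "group G" and "isotopic_to f G"
  shows "isotopic_to_group f"
proof -
  interpret G: group G by fact
  from assms(2) obtain \<alpha> \<beta> \<gamma> where
    a: "bij_betw \<alpha> UNIV (carrier G)" and b: "bij_betw \<beta> UNIV (carrier G)"
    and c: "bij_betw \<gamma> UNIV (carrier G)"
    and eq: "\<And>x y. \<alpha> x \<otimes>\<^bsub>G\<^esub> \<beta> y = \<gamma> (f x y)"
    unfolding isotopic_to_def by blast
  define h where "h = inv_into UNIV \<gamma>"
  have h: "bij_betw h (carrier G) UNIV"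
    unfolding h_def using c by (rule bij_betw_inv_into)
  have gc [simp]: "\<gamma> x \<in> carrier G" for x using c by (auto simp: bij_betw_def)
  have ac [simp]: "\<alpha> x \<in> carrier G" for x using a by (auto simp: bij_betw_def)
  have bc [simp]: "\<beta> x \<in> carrier G" for x using b by (auto simp: bij_betw_def)
  have gh [simp]: "\<gamma> (h g) = g" if "g \<in> carrier G" for g
    unfolding h_def using c that by (rule bij_betw_inv_into_right)
  have hg [simp]: "h (\<gamma> x) = x" for x
    unfolding h_def using c by (simp add: bij_betw_inv_into_left)
  define K :: "'a monoid" where
    "K = \<lparr>carrier = UNIV, monoid.mult = (\<lambda>x y. h (\<gamma> x \<otimes>\<^bsub>G\<^esub> \<gamma> y)), monoid.one = h \<one>\<^bsub>G\<^esub>\<rparr>"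
  have "group K"
  proof (rule groupI)
    fix x assume "x \<in> carrier K"
    show "\<exists>y\<in>carrier K. y \<otimes>\<^bsub>K\<^esub> x = \<one>\<^bsub>K\<^esub>"
      by (rule bexI[of _ "h (inv\<^bsub>G\<^esub> (\<gamma> x))"]) (simp_all add: K_def)
  qed (simp_all add: K_def G.m_assoc)
  moreover have "isotopic_to f K"
    unfolding isotopic_to_def
  proof (intro exI conjI allI)
    show "bij_betw (h \<circ> \<alpha>) UNIV (carrier K)"
      using bij_betw_trans[OF a h] by (simp add: K_def)
    show "bij_betw (h \<circ> \<beta>) UNIV (carrier K)"
      using bij_betw_trans[OF b h] by (simp add: K_def)
    show "bij_betw id UNIV (carrier K)" by (simp add: K_def)
    show "(h \<circ> \<alpha>) x \<otimes>\<^bsub>K\<^esub> (h \<circ> \<beta>) y = id (f x y)" for x y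
      by (simp add: K_def eq)
  qed
  ultimately show ?thesis unfolding isotopic_to_group_def by blast
qed

end

theory Submission
  imports Defs "HOL-Algebra.Sylow" "HOL-Number_Theory.Residues"
begin

text \<open>
  Write $q$ for the order of the field, $\varphi$ for the left translation by $0$, and $K$ for
  the set of squares including $0$, so that $2|K| = q + 1$. Translations, and multiplications by
  nonzero squares, are automorphisms of $Q_{a,b}$; this reduces commutativity, flexibility and
  semisymmetry to finitely many equations in $a$ and $b$.

  Left distributivity says that $\varphi$ is an automorphism. If $a \ne b$ and $a$ is a square,
  this makes $K$ a proper subquasigroup with more than $q/2$ elements, which is impossible. If
  $a$ is a nonsquare, it prevents $z - y$ from being a nonzero square for $y, z \in K$, $y \ne 0$,
  which contradicts $t^2 - 1 = u^2$ with $t \pm u = v^{\pm 1}$. Right distributivity is left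
  distributivity of the opposite quasigroup, which is again quadratic.

  If $Q_{a,b}$ is isotopic to a group, the permutations $L_0^{-1} L_z$ form a group $H$ of order
  $q$ normalised by the translations and by the multiplications by squares. The translations
  form a $p$-group, so they centralise some nontrivial element of $H$, which is then itself a
  translation. Hence the $t$ whose translation lies in $H$ form a nonzero additive subgroup
  closed under multiplication by squares; it has more than $q/2$ elements and is everything. So
  $H$ is the translation group, $\varphi$ is additive, and as $\varphi$ agrees with
  multiplication by $a$ on the more than $q/2$ elements of $K$, it follows that $a = b$.
\<close>

section \<open>The quadratic character of a finite field\<close>

lemma two_neq_zero:
  assumes "odd CARD('a :: {field, finite})"
  shows "(2 :: 'a) \<noteq> 0"
proof
  assume "(2 :: 'a) = 0"
  then have "CHAR('a) dvd 2"
    by (metis of_nat_eq_0_iff_char_dvd of_nat_numeral)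
  moreover have "CHAR('a) \<noteq> 1" by simp
  ultimately have "CHAR('a) = 2"
    by (metis prime_nat_iff two_is_prime_nat)
  then show False
    using CHAR_dvd_CARD[where 'a = 'a] assms by simp
qed

text \<open>Squaring is two-to-one on the nonzero elements: the fibre through \<open>z\<close> is
  \<open>{z, - z}\<close>, and \<open>z\<close> differs from \<open>- z\<close> because 2 is
  nonzero.\<close>

lemma card_squares_nonzero:
  assumes "odd CARD('a :: {field, finite})"
  shows "2 * card ((\<lambda>z :: 'a. z\<^sup>2) ` (- {0})) = CARD('a) - 1"
proof -
  let ?sq = "\<lambda>z :: 'a. z\<^sup>2"
  have fib: "card {x. x \<in> - {0} \<and> ?sq x = y} = 2" if "y \<in> ?sq ` (- {0})" for y
  proof -
    from that obtain z where z: "z \<noteq> 0" "y = z\<^sup>2" by auto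
    have "{x. x \<in> - {0} \<and> ?sq x = y} = {z, - z}"
      using z by (auto simp: power2_eq_iff)
    moreover have "z \<noteq> - z"
      using z two_neq_zero[OF assms] by (metis add.right_inverse mult_2 mult_eq_0_iff)
    ultimately show ?thesis by simp
  qed
  have "CARD('a) - 1 = (\<Sum>x \<in> - {0 :: 'a}. 1)"
    by (simp add: Compl_eq_Diff_UNIV card_Diff_subset)
  also have "\<dots> = (\<Sum>y \<in> ?sq ` (- {0}). \<Sum>x | x \<in> - {0} \<and> ?sq x = y. 1)"
    by (rule sum.image_gen) simp
  also have "\<dots> = (\<Sum>y \<in> ?sq ` (- {0}). 2)"
    using fib by (intro sum.cong) auto
  finally show ?thesis by simp
qed

lemma card_quad_char_eq_1:
  assumes "odd CARD('a :: {field, finite})"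
  shows "2 * card {x :: 'a. quad_char x = 1} = CARD('a) - 1"
proof -
  have "{x :: 'a. quad_char x = 1} = (\<lambda>z. z\<^sup>2) ` (- {0})"
    by (auto simp: quad_char_def)
  then show ?thesis using card_squares_nonzero[OF assms] by simp
qed

text \<open>Counting 0 among the squares turns them into a strict majority of the field; every
  counting argument below rests on this.\<close>

lemma card_quad_char_ge_0:
  assumes "odd CARD('a :: {field, finite})"
  shows "2 * card {x :: 'a. quad_char x \<ge> 0} = CARD('a) + 1"
proof -
  have "{x :: 'a. quad_char x \<ge> 0} = insert 0 {x. quad_char x = 1}"
    by (auto simp: quad_char_def)
  moreover have "(0 :: 'a) \<notin> {x. quad_char x = 1}" by (simp add: quad_char_def)
  moreover have "CARD('a) > 0" by simp
  ultimately show ?thesis using card_quad_char_eq_1[OF assms] by simp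
qed

lemma card_quad_char_eq_neg_1:
  assumes "odd CARD('a :: {field, finite})"
  shows "2 * card {x :: 'a. quad_char x = - 1} = CARD('a) - 1"
proof -
  have "{x :: 'a. quad_char x = - 1} = - {x. quad_char x \<ge> 0}"
    by (auto simp: quad_char_def)
  then show ?thesis using card_quad_char_ge_0[OF assms]
    by (simp add: Compl_eq_Diff_UNIV card_Diff_subset)
qed

lemma quad_char_0_iff [simp]: "quad_char x = 0 \<longleftrightarrow> x = 0"
  by (simp add: quad_char_def)

lemma quad_char_0 [simp]: "quad_char 0 = 0"
  by (simp add: quad_char_def)

lemma quad_char_1 [simp]: "quad_char 1 = 1"
  unfolding quad_char_def using power_one[of 2] by (metis zero_neq_one)

lemma quad_char_nonzero: "x \<noteq> 0 \<Longrightarrow> quad_char x = 1 \<or> quad_char x = - 1"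
  by (simp add: quad_char_def)

lemma quad_char_square [simp]: "z \<noteq> 0 \<Longrightarrow> quad_char (z\<^sup>2) = 1"
  by (auto simp: quad_char_def)

lemma quad_char_square_mult:
  assumes "z \<noteq> 0"
  shows "quad_char (z\<^sup>2 * x) = quad_char x"
proof -
  have "(\<exists>y. z\<^sup>2 * x = y\<^sup>2) \<longleftrightarrow> (\<exists>y. x = y\<^sup>2)"
  proof
    assume "\<exists>y. z\<^sup>2 * x = y\<^sup>2"
    then obtain y where "z\<^sup>2 * x = y\<^sup>2" by blast
    then have "x = (y / z)\<^sup>2" using assms by (simp add: power_divide field_simps)
    then show "\<exists>y. x = y\<^sup>2" by blast
  qed (metis power_mult_distrib)
  then show ?thesis using assms by (simp add: quad_char_def)
qed

text \<open>Nonzero square factors do not affect the character. For two nonsquares \<open>x\<close>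
  and \<open>y\<close>, multiplication by \<open>x\<close> sends the nonzero squares into the
  nonsquares, and onto them since both sets have the same size; so \<open>y = x * s\<close> with
  \<open>s\<close> a square, and \<open>x * y\<close> is \<open>x\<close> squared times
  \<open>s\<close>.\<close>

lemma quad_char_mult:
  fixes x y :: "'a :: {field, finite}"
  assumes odd: "odd CARD('a)"
  shows "quad_char (x * y) = quad_char x * quad_char y"
proof -
  have sq: "quad_char (u * v) = quad_char v" if "quad_char u = 1" for u v :: 'a
  proof -
    from that obtain z where "u = z\<^sup>2" "z \<noteq> 0"
      by (auto simp: quad_char_def split: if_splits)
    then show ?thesis by (simp add: quad_char_square_mult)
  qed
  consider "x = 0 \<or> y = 0" | "quad_char x = 1" | "quad_char y = 1"
    | "quad_char x = - 1" "quad_char y = - 1"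
    using quad_char_nonzero by metis
  then show ?thesis
  proof cases
    case 4
    let ?S = "{u :: 'a. quad_char u = 1}" and ?N = "{u :: 'a. quad_char u = - 1}"
    have x: "x \<noteq> 0" using 4 by auto
    have "(*) x ` ?S \<subseteq> ?N" using sq 4 by (auto simp: mult.commute[of x])
    moreover have "card ((*) x ` ?S) = card ?N"
    proof -
      have "card ((*) x ` ?S) = card ?S"
        using x by (intro card_image) (auto simp: inj_on_def)
      then show ?thesis
        using card_quad_char_eq_1[OF odd] card_quad_char_eq_neg_1[OF odd] by simp
    qed
    ultimately have "(*) x ` ?S = ?N" by (intro card_subset_eq) auto
    then obtain s where "quad_char s = 1" "y = x * s" using 4 by blast
    then have "x * y = x\<^sup>2 * s" by (simp add: power2_eq_square)
    then show ?thesis using 4 x \<open>quad_char s = 1\<close> by (simp add: quad_char_square_mult)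
  next
    case 3
    then show ?thesis using sq[of y x] by (simp add: mult.commute)
  qed (use sq in auto)
qed

lemma even_card_involution:
  assumes "finite A" "\<And>x. x \<in> A \<Longrightarrow> h x \<in> A" "\<And>x. x \<in> A \<Longrightarrow> h (h x) = x"
    "\<And>x. x \<in> A \<Longrightarrow> h x \<noteq> x"
  shows "even (card A)"
proof -
  have "2 dvd card (\<Union> ((\<lambda>x. {x, h x}) ` A))"
  proof (rule dvd_partition)
    show "\<forall>c \<in> (\<lambda>x. {x, h x}) ` A. 2 dvd card c" using assms(4) by (fastforce simp: card_insert_if)
    show "\<forall>c1 \<in> (\<lambda>x. {x, h x}) ` A. \<forall>c2 \<in> (\<lambda>x. {x, h x}) ` A. c1 \<noteq> c2 \<longrightarrow> c1 \<inter> c2 = {}"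
    proof (intro ballI impI)
      fix c1 c2 assume "c1 \<in> (\<lambda>x. {x, h x}) ` A" "c2 \<in> (\<lambda>x. {x, h x}) ` A" "c1 \<noteq> c2"
      then obtain x y where "x \<in> A" "y \<in> A" "c1 = {x, h x}" "c2 = {y, h y}" by blast
      moreover from this have "x \<noteq> y" "x \<noteq> h y" "h x \<noteq> y" "h x \<noteq> h y"
        using assms(3) \<open>c1 \<noteq> c2\<close> by (metis insert_commute)+
      ultimately show "c1 \<inter> c2 = {}" by simp
    qed
  qed (use assms in auto)
  moreover have "\<Union> ((\<lambda>x. {x, h x}) ` A) = A" using assms(2) by auto
  ultimately show ?thesis by simp
qed

text \<open>Inversion permutes the nonzero squares \<open>S\<close> and can fix only 1 and -1. Hence
  the parity of \<open>card S\<close>, which is half of the order minus one, decides whether -1 lies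
  in \<open>S\<close>.\<close>

lemma quad_char_minus_1_iff:
  assumes "odd CARD('a :: {field, finite})"
  shows "quad_char (- 1 :: 'a) = - 1 \<longleftrightarrow> [CARD('a) = 3] (mod 4)"
proof -
  define S where "S = {x :: 'a. quad_char x = 1}"
  have S: "2 * card S = CARD('a) - 1" unfolding S_def by (rule card_quad_char_eq_1[OF assms])
  have inv: "inverse x \<in> S" if "x \<in> S" for x
  proof -
    have "x \<noteq> 0" using that by (auto simp: S_def)
    then have "quad_char x * quad_char (inverse x) = 1"
      using quad_char_mult[OF assms, of x "inverse x"] by simp
    then show ?thesis using that by (simp add: S_def)
  qed
  have "even (card (S - {1, - 1}))"
  proof (rule even_card_involution[of _ inverse])
    fix x assume x: "x \<in> S - {1, - 1}"
    then have "x \<noteq> 0" by (auto simp: S_def)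
    show "inverse x \<noteq> x"
    proof
      assume "inverse x = x"
      then have "x\<^sup>2 = 1" using \<open>x \<noteq> 0\<close> by (metis power2_eq_square right_inverse)
      then show False using x by (simp add: power2_eq_1_iff)
    qed
    show "inverse x \<in> S - {1, - 1}"
      using x inv inverse_inverse_eq[of x] by fastforce
  qed simp_all
  moreover have "(1 :: 'a) \<in> S" by (simp add: S_def)
  moreover have "(1 :: 'a) \<noteq> - 1"
    using two_neq_zero[OF assms] by (metis add.right_inverse one_add_one)
  moreover have "- 1 \<in> S \<or> quad_char (- 1 :: 'a) = - 1"
    using quad_char_nonzero[of "- 1 :: 'a"] by (auto simp: S_def)
  moreover have "card S = card (S - {1, - 1}) + (if - 1 \<in> S then 2 else 1)"
  proof -
    have "card S = card (S - {1, - 1}) + card (S \<inter> {1, - 1})"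
      by (subst card_Un_disjoint[symmetric]) (auto intro: arg_cong[of _ _ card])
    moreover have "S \<inter> {1, - 1} = (if - 1 \<in> S then {1, - 1} else {1})"
      using \<open>1 \<in> S\<close> by auto
    ultimately show ?thesis using \<open>1 \<noteq> - 1\<close> by simp
  qed
  ultimately have "quad_char (- 1 :: 'a) = - 1 \<longleftrightarrow> odd (card S)"
    by (auto simp: S_def)
  also have "\<dots> \<longleftrightarrow> [CARD('a) = 3] (mod 4)"
  proof -
    have C: "CARD('a) = 2 * card S + 1" using S assms odd_pos[of "CARD('a)"] by simp
    show ?thesis unfolding C cong_def by presburger
  qed
  finally show ?thesis .
qed

lemma exists_nonsquare:
  assumes "odd CARD('a :: {field, finite})"
  shows "\<exists>n :: 'a. quad_char n = - 1"
proof (rule ccontr)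
  assume "\<nexists>n :: 'a. quad_char n = - 1"
  then have "{x :: 'a. quad_char x = - 1} = {}" by simp
  then have "CARD('a) - 1 = 0"
    using card_quad_char_eq_neg_1[OF assms] by (metis card.empty mult_0_right)
  moreover have "card {0, 1 :: 'a} \<le> CARD('a)" by (rule card_mono) simp_all
  ultimately show False by simp
qed

text \<open>Pigeonhole: \<open>A\<close> and its reflection under \<open>x\<close> to
  \<open>v - x\<close> are too large to be disjoint.\<close>

lemma sum_of_two_from_majority:
  fixes A :: "'a :: {ab_group_add, finite} set"
  assumes "CARD('a) < 2 * card A"
  obtains x y where "x \<in> A" "y \<in> A" "v = x + y"
proof -
  have "A \<inter> (\<lambda>x. v - x) ` A \<noteq> {}"
  proof
    assume "A \<inter> (\<lambda>x. v - x) ` A = {}"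
    then have "card (A \<union> (\<lambda>x. v - x) ` A) = card A + card ((\<lambda>x. v - x) ` A)"
      by (intro card_Un_disjoint) simp_all
    moreover have "card ((\<lambda>x. v - x) ` A) = card A"
      by (intro card_image) (auto simp: inj_on_def)
    moreover have "card (A \<union> (\<lambda>x. v - x) ` A) \<le> CARD('a)" by (rule card_mono) simp_all
    ultimately show False using assms by simp
  qed
  then show thesis using that by force
qed

section \<open>Fixed points of actions of the additive group\<close>

text \<open>This structure serves twice: Sylow's theorem is applied to it, and it is the target of
  the isotopy when \<open>a = b\<close>.\<close>

definition additive_group :: "'a :: ab_group_add monoid" where
  "additive_group = \<lparr>carrier = UNIV, monoid.mult = (+), one = 0\<rparr>"

lemma group_additive_group: "Group.group additive_group"
proof (rule groupI)
  fix x :: 'a assume "x \<in> carrier additive_group"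
  show "\<exists>y\<in>carrier additive_group. y \<otimes>\<^bsub>additive_group\<^esub> x = \<one>\<^bsub>additive_group\<^esub>"
    by (rule bexI[of _ "- x"]) (simp_all add: additive_group_def)
qed (simp_all add: additive_group_def add.assoc)

text \<open>This is the form in which the additive group is known to be a p-group. Sylow's theorem,
  used with exponent 1, gives a subgroup of order \<open>r\<close>; a nonzero element of it is
  annihilated by \<open>r\<close>, so the characteristic divides \<open>r\<close>.\<close>

lemma prime_dvd_CARD_eq_CHAR:
  assumes "prime r" and "r dvd CARD('a :: {field, finite})"
  shows "r = CHAR('a)"
proof -
  let ?G = "additive_group :: 'a monoid"
  have pow: "x [^]\<^bsub>?G\<^esub> n = of_nat n * x" for x :: 'a and n :: nat
    by (induction n) (simp_all add: nat_pow_def, simp_all add: additive_group_def algebra_simps)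
  from assms(2) obtain m where "order ?G = r ^ 1 * m"
    by (auto simp: order_def additive_group_def elim: dvdE)
  then obtain H where H: "subgroup H ?G" "card H = r"
    using sylow_thm[of r ?G 1 m] assms(1) group_additive_group by (auto simp: additive_group_def)
  have "\<not> H \<subseteq> {0}"
    using H(2) prime_gt_1_nat[OF assms(1)] card_mono[of "{0}" H] by auto
  then obtain x where x: "x \<in> H" "x \<noteq> 0" by blast
  have "x [^]\<^bsub>?G\<lparr>carrier := H\<rparr>\<^esub> r = \<one>\<^bsub>?G\<lparr>carrier := H\<rparr>\<^esub>"
    using group.pow_order_eq_1[OF subgroup.subgroup_is_group[OF H(1) group_additive_group], of x] x(1) H(2)
    by (simp add: order_def)
  then have "of_nat r * x = 0"
    using pow[of x r] by (simp add: nat_pow_def additive_group_def)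
  then have "CHAR('a) dvd r" using x(2) by (simp add: of_nat_eq_0_iff_char_dvd)
  then show ?thesis
    using assms(1) by (metis CHAR_not_1' One_nat_def prime_nat_iff)
qed

text \<open>Orbit counting for a p-group: an orbit that is not a single point has size divisible by
  the characteristic. If \<open>e\<close> were the only fixed point, the characteristic would divide
  both \<open>card X\<close> and \<open>card X - 1\<close>.\<close>

lemma additive_action_fixed_point:
  fixes act :: "'a :: {field, finite} \<Rightarrow> 'x \<Rightarrow> 'x"
  assumes "finite X" and dvd: "CHAR('a) dvd card X"
    and closed: "\<And>t x. x \<in> X \<Longrightarrow> act t x \<in> X"
    and act_0: "\<And>x. x \<in> X \<Longrightarrow> act 0 x = x"
    and act_add: "\<And>s t x. x \<in> X \<Longrightarrow> act (s + t) x = act s (act t x)"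
    and e: "e \<in> X" "\<And>t. act t e = e"
  shows "\<exists>x\<in>X. x \<noteq> e \<and> (\<forall>t. act t x = x)"
proof (rule ccontr)
  assume none: "\<not> ?thesis"
  define orb where "orb x = range (\<lambda>t. act t x)" for x
  have in_orb: "x \<in> orb x" if "x \<in> X" for x
    using act_0[OF that] unfolding orb_def by (metis rangeI)
  have cancel: "act (- t) (act t x) = x" if "x \<in> X" for t x
    using act_add[OF that, of "- t" t] act_0[OF that] by simp
  have orb_eq: "orb (act t x) = orb x" if "x \<in> X" for t x
  proof
    show "orb (act t x) \<subseteq> orb x"
      unfolding orb_def using act_add[OF that] by (metis image_subsetI rangeI)
    show "orb x \<subseteq> orb (act t x)"
    proof
      fix y assume "y \<in> orb x"
      then obtain s where "y = act s x" by (auto simp: orb_def)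
      then have "y = act (s - t) (act t x)" using act_add[OF that, of "s - t" t] by simp
      then show "y \<in> orb (act t x)" by (auto simp: orb_def)
    qed
  qed
  have card_orb: "CHAR('a) dvd card (orb x)" if x: "x \<in> X - {e}" for x
  proof -
    define St where "St = {t. act t x = x}"
    have fib: "card {t. t \<in> UNIV \<and> act t x = y} = card St" if "y \<in> orb x" for y
    proof -
      from that obtain s where s: "y = act s x" by (auto simp: orb_def)
      \<comment> \<open>The elements carrying \<open>x\<close> to \<open>y\<close> form a coset of
        the stabiliser, so all fibres over the orbit have equal size and the orbit length divides
        the order of the field.\<close>
      have "{t. t \<in> UNIV \<and> act t x = y} = (+) s ` St"
      proof (intro equalityI subsetI)
        fix t assume "t \<in> {t. t \<in> UNIV \<and> act t x = y}"
        then have "act (t - s) x = x"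
          using act_add[of x "- s" t] cancel[of x s] x s by simp
        then show "t \<in> (+) s ` St" by (intro image_eqI[of _ _ "t - s"]) (auto simp: St_def)
      qed (use act_add x s in \<open>auto simp: St_def\<close>)
      then show ?thesis by (simp add: card_image)
    qed
    have "CARD('a) = (\<Sum>t \<in> (UNIV :: 'a set). 1)" by simp
    also have "\<dots> = (\<Sum>y \<in> orb x. \<Sum>t | t \<in> UNIV \<and> act t x = y. 1)"
      unfolding orb_def by (rule sum.image_gen) simp
    also have "\<dots> = (\<Sum>y \<in> orb x. card St)"
      using fib by (intro sum.cong) auto
    finally have "card (orb x) dvd CARD('a)" by simp
    moreover have "card (orb x) \<noteq> 1"
    proof
      assume "card (orb x) = 1"
      then obtain z where "orb x = {z}" by (auto simp: card_1_singleton_iff)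
      then have "act t x = x" for t
        using in_orb[of x] x by (auto simp: orb_def)
      then show False using none x by blast
    qed
    then obtain r where "prime r" "r dvd card (orb x)" using prime_factor_nat by blast
    ultimately show ?thesis using prime_dvd_CARD_eq_CHAR[of r, where 'a = 'a] by auto
  qed
  have "CHAR('a) dvd card (\<Union> (orb ` (X - {e})))"
  proof (rule dvd_partition)
    show "\<forall>c \<in> orb ` (X - {e}). CHAR('a) dvd card c" using card_orb by blast
    show "\<forall>c1 \<in> orb ` (X - {e}). \<forall>c2 \<in> orb ` (X - {e}). c1 \<noteq> c2 \<longrightarrow> c1 \<inter> c2 = {}"
    proof (intro ballI impI, rule ccontr)
      fix c1 c2 assume "c1 \<in> orb ` (X - {e})" "c2 \<in> orb ` (X - {e})" "c1 \<noteq> c2" "c1 \<inter> c2 \<noteq> {}"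
      then obtain x y z where "x \<in> X" "y \<in> X" "c1 = orb x" "c2 = orb y" "z \<in> orb x" "z \<in> orb y"
        by blast
      moreover have "orb z = orb w" if "w \<in> X" "z \<in> orb w" for w
        using that orb_eq[of w] unfolding orb_def[of w] by auto
      ultimately show False using \<open>c1 \<noteq> c2\<close> by metis
    qed
    show "finite (\<Union> (orb ` (X - {e})))" using \<open>finite X\<close> by (auto simp: orb_def)
  qed
  moreover have "\<Union> (orb ` (X - {e})) = X - {e}"
  proof (intro equalityI subsetI)
    fix y assume "y \<in> \<Union> (orb ` (X - {e}))"
    then obtain x t where xt: "x \<in> X" "x \<noteq> e" "y = act t x" by (auto simp: orb_def)
    then have "y \<noteq> e" using cancel[of x t] e(2) by metis
    then show "y \<in> X - {e}" using xt closed by blast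
  qed (use in_orb in blast)
  ultimately have "CHAR('a) dvd card X - 1" using \<open>finite X\<close> e(1) by simp
  moreover have "card X > 0" using \<open>finite X\<close> e(1) by (auto simp: card_gt_0_iff)
  ultimately have "CHAR('a) dvd 1" using dvd
    by (metis One_nat_def Suc_leI dvd_diffD1)
  then show False by simp
qed

section \<open>Quadratic quasigroups\<close>

text \<open>The argument is a sign rather than a field element, so that nested products become sign
  computations which the simplifier can evaluate at 0, 1 and -1.\<close>

definition coef :: "'a :: field \<Rightarrow> 'a \<Rightarrow> int \<Rightarrow> 'a" where
  "coef a b \<sigma> = (if \<sigma> \<ge> 0 then a else b)"

lemma quad_qg_coef: "quad_qg a b x y = x + coef a b (quad_char (y - x)) * (y - x)"
  by (simp add: quad_qg_def coef_def)

lemma coef_eqs [simp]: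
  "coef a b 0 = a" "coef a b 1 = a" "coef a b (- 1) = b" "coef a a \<sigma> = a"
  by (simp_all add: coef_def)

lemma quad_qg_translate: "quad_qg a b (x + t) (y + t) = quad_qg a b x y + t"
  by (simp add: quad_qg_coef)

lemma quad_qg_scale:
  assumes "s \<noteq> 0"
  shows "quad_qg a b (s\<^sup>2 * x) (s\<^sup>2 * y) = s\<^sup>2 * quad_qg a b x y"
proof -
  have "quad_char (s\<^sup>2 * y - s\<^sup>2 * x) = quad_char (y - x)"
    using quad_char_square_mult[OF assms, of "y - x"] by (simp add: right_diff_distrib)
  then show ?thesis by (simp add: quad_qg_coef coef_def algebra_simps)
qed

text \<open>For any coefficient \<open>c\<close>,
  \<open>x + c * (y - x) = y + (1 - c) * (x - y)\<close>. Whether the two coefficients also change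
  places depends on whether negation flips the character.\<close>

lemma quad_qg_opposite:
  fixes a b x y :: "'a :: {field, finite}"
  assumes odd: "odd CARD('a)"
  shows "quad_char (- 1 :: 'a) = 1 \<Longrightarrow> quad_qg a b x y = quad_qg (1 - a) (1 - b) y x"
    and "quad_char (- 1 :: 'a) = - 1 \<Longrightarrow> quad_qg a b x y = quad_qg (1 - b) (1 - a) y x"
proof -
  have "quad_char (x - y) = quad_char (- 1 :: 'a) * quad_char (y - x)"
    using quad_char_mult[OF odd, of "- 1" "y - x"] by simp
  then show "quad_char (- 1 :: 'a) = 1 \<Longrightarrow> quad_qg a b x y = quad_qg (1 - a) (1 - b) y x"
    and "quad_char (- 1 :: 'a) = - 1 \<Longrightarrow> quad_qg a b x y = quad_qg (1 - b) (1 - a) y x"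
    using quad_char_nonzero[of "y - x"]
    by (cases "x = y"; force simp: quad_qg_def algebra_simps)+
qed

text \<open>Both coefficients have the same character, so the product reveals the character of
  \<open>y - x\<close>. Equal products therefore use the same coefficient, which is nonzero.\<close>

lemma quad_qg_left_cancel:
  fixes a b x y z :: "'a :: {field, finite}"
  assumes odd: "odd CARD('a)" and ab: "quad_char a = quad_char b" "quad_char a \<noteq> 0"
    and eq: "quad_qg a b x y = quad_qg a b x z"
  shows "y = z"
proof -
  have char_eq: "quad_char (coef a b (quad_char t) * t) = quad_char a * quad_char t" for t
    using ab by (simp add: coef_def quad_char_mult[OF odd])
  have "coef a b (quad_char (y - x)) * (y - x) = coef a b (quad_char (z - x)) * (z - x)"
    using eq by (simp add: quad_qg_coef)
  moreover from this have "quad_char (y - x) = quad_char (z - x)"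
    using char_eq[of "y - x"] char_eq[of "z - x"] ab by simp
  ultimately show ?thesis using ab by (auto simp: coef_def split: if_splits)
qed

lemma quad_qg_right_cancel:
  fixes a b x y z :: "'a :: {field, finite}"
  assumes odd: "odd CARD('a)"
    and ab: "quad_char (1 - a) = quad_char (1 - b)" "quad_char (1 - a) \<noteq> 0"
    and eq: "quad_qg a b x z = quad_qg a b y z"
  shows "x = y"
proof -
  consider "quad_char (- 1 :: 'a) = 1" | "quad_char (- 1 :: 'a) = - 1"
    using quad_char_nonzero[of "- 1 :: 'a"] by auto
  then show ?thesis
  proof cases
    case 1
    then have "quad_qg (1 - a) (1 - b) z x = quad_qg (1 - a) (1 - b) z y"
      using eq quad_qg_opposite(1)[OF odd] by metis
    then show ?thesis by (rule quad_qg_left_cancel[OF odd ab])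
  next
    case 2
    then have "quad_qg (1 - b) (1 - a) z x = quad_qg (1 - b) (1 - a) z y"
      using eq quad_qg_opposite(2)[OF odd] by metis
    then show ?thesis by (rule quad_qg_left_cancel[OF odd, rotated 2]) (use ab in simp_all)
  qed
qed

section \<open>Distributivity and mediality\<close>

text \<open>A proper subquasigroup fills at most half of a finite quasigroup: right multiplication
  by an outside element \<open>n\<close> embeds \<open>K\<close> into its complement.\<close>

lemma closed_majority_eq_UNIV:
  fixes f :: "'a :: finite \<Rightarrow> 'a \<Rightarrow> 'a"
  assumes left: "\<And>x y z. f x y = f x z \<Longrightarrow> y = z" and right: "\<And>x y z. f x z = f y z \<Longrightarrow> x = y"
    and closed: "\<And>x y. x \<in> K \<Longrightarrow> y \<in> K \<Longrightarrow> f x y \<in> K"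
    and majority: "CARD('a) < 2 * card K"
  shows "K = UNIV"
proof (rule ccontr)
  assume "K \<noteq> UNIV"
  then obtain n where n: "n \<notin> K" by blast
  have "f k n \<notin> K" if "k \<in> K" for k
  proof
    assume "f k n \<in> K"
    \<comment> \<open>Left multiplication by \<open>k\<close> already permutes \<open>K\<close>, so
      a product \<open>f k n\<close> in \<open>K\<close> would be \<open>f k m\<close> for some
      \<open>m\<close> in \<open>K\<close>, forcing \<open>n = m\<close>.\<close>
    moreover have "f k ` K = K"
      using left closed that by (intro endo_inj_surj) (auto simp: inj_on_def)
    ultimately show False using left n by (metis imageE)
  qed
  then have "(\<lambda>k. f k n) ` K \<subseteq> - K" by blast
  then have "card ((\<lambda>k. f k n) ` K) \<le> card (- K)" by (intro card_mono) simp_all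
  moreover have "card ((\<lambda>k. f k n) ` K) = card K"
    using right by (intro card_image) (auto simp: inj_on_def)
  moreover have "card (- K) = CARD('a) - card K" by (simp add: Compl_eq_Diff_UNIV card_Diff_subset)
  ultimately show False using majority by simp
qed

lemma left_distributive_quad_qg_imp_eq:
  fixes a b :: "'a :: {field, finite}"
  assumes odd: "odd CARD('a)"
    and ab: "quad_char a = quad_char b" "quad_char a \<noteq> 0"
      "quad_char (1 - a) = quad_char (1 - b)" "quad_char (1 - a) \<noteq> 0"
    and ld: "left_distributive (quad_qg a b)"
  shows "a = b"
proof (rule ccontr)
  assume neq: "a \<noteq> b"
  have nz: "a \<noteq> 0" "b \<noteq> 0" "a \<noteq> 1" "b \<noteq> 1" using ab by auto
  define K where "K = {y :: 'a. quad_char y \<ge> 0}"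
  \<comment> \<open>On \<open>K\<close> the left translation by 0 is plain multiplication by
    \<open>a\<close>.\<close>
  have K: "quad_qg a b 0 (quad_qg a b y z) = quad_qg a b (a * y) (a * z)"
    if "y \<in> K" "z \<in> K" for y z
  proof -
    have "quad_qg a b 0 y = a * y" "quad_qg a b 0 z = a * z"
      using that by (simp_all add: K_def quad_qg_def)
    then show ?thesis using ld unfolding left_distributive_def by metis
  qed
  consider "quad_char a = 1" | "quad_char a = - 1" using quad_char_nonzero nz by blast
  then show False
  proof cases
    case 1
    then obtain s where s: "a = s\<^sup>2" "s \<noteq> 0"
      by (auto simp: quad_char_def split: if_splits)
    \<comment> \<open>Scaling by the square \<open>a\<close> is an automorphism, so distributivity
      multiplies the product by \<open>a\<close>; outside \<open>K\<close> it would have to be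
      multiplied by \<open>b\<close>.\<close>
    have closed: "quad_qg a b y z \<in> K" if "y \<in> K" "z \<in> K" for y z
    proof (rule ccontr)
      let ?w = "quad_qg a b y z"
      assume "?w \<notin> K"
      then have "quad_qg a b 0 ?w = b * ?w" "?w \<noteq> 0" by (auto simp: K_def quad_qg_def)
      moreover have "quad_qg a b 0 ?w = a * ?w"
        using K[OF that] quad_qg_scale[OF s(2), of a b y z] s(1) by simp
      ultimately show False using neq by simp
    qed
    have "CARD('a) < 2 * card K"
      unfolding K_def using card_quad_char_ge_0[OF odd] by simp
    then have "K = UNIV"
      by (rule closed_majority_eq_UNIV[rotated 3])
        (fact quad_qg_left_cancel[OF odd ab(1,2)] quad_qg_right_cancel[OF odd ab(3,4)] closed)+
    moreover obtain n :: 'a where "quad_char n = - 1" using exists_nonsquare[OF odd] by blast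
    then have "n \<notin> K" by (simp add: K_def)
    ultimately show False by simp
  next
    case 2
    have no_square: "\<not> (y \<in> K \<and> z \<in> K \<and> y \<noteq> 0 \<and> quad_char (z - y) = 1)" for y z
    proof
      assume yz: "y \<in> K \<and> z \<in> K \<and> y \<noteq> 0 \<and> quad_char (z - y) = 1"
      then have "quad_char (a * z - a * y) = - 1"
        using quad_char_mult[OF odd, of a "z - y"] 2 by (simp add: right_diff_distrib)
      then have "quad_qg a b (a * y) (a * z) = a * y + b * (a * (z - y))"
        by (simp add: quad_qg_coef right_diff_distrib)
      moreover have "quad_qg a b y z = y + a * (z - y)"
        using yz by (simp add: quad_qg_coef)
      ultimately have
        "coef a b (quad_char (y + a * (z - y))) * (y + a * (z - y)) = a * y + b * (a * (z - y))"
        using K[of y z] yz by (simp add: quad_qg_coef[of a b 0])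
      \<comment> \<open>The two cases are the two possible characters of the product of
        \<open>y\<close> and \<open>z\<close>; each makes a product of nonzero factors
        vanish.\<close>
      then consider "a * (y + a * (z - y)) = a * y + b * (a * (z - y))"
        | "b * (y + a * (z - y)) = a * y + b * (a * (z - y))"
        by (auto simp: coef_def split: if_splits)
      then show False
      proof cases
        case 1
        then have "(a - b) * (a * (z - y)) = 0" by (simp add: algebra_simps)
        then show False using neq nz yz by auto
      next
        case 2
        then have "(b - a) * y = 0" by (simp add: algebra_simps)
        then show False using neq yz by auto
      qed
    qed
    \<comment> \<open>Since \<open>a\<close> and \<open>b\<close> are distinct and both avoid 0 and
      1, at least one of them also avoids -1.\<close>
    obtain v :: 'a where v: "v \<noteq> 0" "v \<noteq> 1" "v \<noteq> - 1" using nz neq by metis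
    have two: "(2 :: 'a) \<noteq> 0" by (rule two_neq_zero[OF odd])
    \<comment> \<open>This is the point of the hyperbola \<open>t^2 - u^2 = 1\<close> with
      \<open>t + u = v\<close> and \<open>t - u = 1 / v\<close>; excluding 1 and -1 for
      \<open>v\<close> keeps \<open>u\<close> nonzero. The pair 1, \<open>t^2\<close> will
      contradict \<open>no_square\<close>.\<close>
    define t u where "t = (v + 1 / v) / 2" and "u = (v - 1 / v) / 2"
    have "u \<noteq> 0"
    proof
      assume "u = 0"
      then have "v\<^sup>2 = 1" using v two by (simp add: u_def field_simps power2_eq_square)
      then show False using v by (simp add: power2_eq_1_iff)
    qed
    moreover have "t\<^sup>2 - 1 = u\<^sup>2"
    proof -
      have "2 * t = v + 1 / v" "2 * u = v - 1 / v" using two by (simp_all add: t_def u_def)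
      then have "2 * (t + u) = 2 * v" "2 * (t - u) = 2 * (1 / v)"
        by (simp_all only: distrib_left right_diff_distrib) simp_all
      then have "t + u = v" "t - u = 1 / v" using two by (metis mult_left_cancel)+
      then have "(t + u) * (t - u) = 1" using v by simp
      then show ?thesis by (simp add: power2_eq_square algebra_simps)
    qed
    ultimately have "quad_char (t\<^sup>2 - 1) = 1" by simp
    moreover have "t\<^sup>2 \<in> K" by (cases "t = 0") (simp_all add: K_def)
    ultimately show False using no_square[of 1 "t\<^sup>2"] by (simp add: K_def)
  qed
qed

lemma left_distributive_quad_qg_iff:
  fixes a b :: "'a :: {field, finite}"
  assumes "odd CARD('a)"
    and "quad_char a = quad_char b" "quad_char a \<noteq> 0"
    and "quad_char (1 - a) = quad_char (1 - b)" "quad_char (1 - a) \<noteq> 0"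
  shows "left_distributive (quad_qg a b) \<longleftrightarrow> a = b"
proof
  assume "a = b"
  then show "left_distributive (quad_qg a b)"
    by (simp add: left_distributive_def quad_qg_coef algebra_simps)
qed (rule left_distributive_quad_qg_imp_eq[OF assms])

lemma right_distributive_quad_qg_iff:
  fixes a b :: "'a :: {field, finite}"
  assumes odd: "odd CARD('a)"
    and ab: "quad_char a = quad_char b" "quad_char a \<noteq> 0"
      "quad_char (1 - a) = quad_char (1 - b)" "quad_char (1 - a) \<noteq> 0"
  shows "right_distributive (quad_qg a b) \<longleftrightarrow> a = b"
proof -
  have opp: "right_distributive (quad_qg a b) \<longleftrightarrow> left_distributive g"
    if "\<And>x y. quad_qg a b x y = g y x" for g
    unfolding right_distributive_def left_distributive_def that by metis
  consider "quad_char (- 1 :: 'a) = 1" | "quad_char (- 1 :: 'a) = - 1"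
    using quad_char_nonzero[of "- 1 :: 'a"] by auto
  then show ?thesis
  proof cases
    case 1
    have "right_distributive (quad_qg a b) \<longleftrightarrow> left_distributive (quad_qg (1 - a) (1 - b))"
      by (rule opp) (rule quad_qg_opposite(1)[OF odd 1])
    also have "\<dots> \<longleftrightarrow> 1 - a = 1 - b"
      by (rule left_distributive_quad_qg_iff[OF odd]) (use ab in simp_all)
    finally show ?thesis by simp
  next
    case 2
    have "right_distributive (quad_qg a b) \<longleftrightarrow> left_distributive (quad_qg (1 - b) (1 - a))"
      by (rule opp) (rule quad_qg_opposite(2)[OF odd 2])
    also have "\<dots> \<longleftrightarrow> 1 - b = 1 - a"
      by (rule left_distributive_quad_qg_iff[OF odd]) (use ab in simp_all)
    finally show ?thesis by auto
  qed
qed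

lemma idempotent_quad_qg: "idempotent_op (quad_qg a b)"
  by (simp add: idempotent_op_def quad_qg_coef)

text \<open>Idempotence reduces mediality to left distributivity: replace the left factor
  \<open>x\<close> of \<open>x * (y * z)\<close> by \<open>x * x\<close> and exchange the inner
  factors.\<close>

lemma medial_quad_qg_iff:
  fixes a b :: "'a :: {field, finite}"
  assumes "odd CARD('a)"
    and "quad_char a = quad_char b" "quad_char a \<noteq> 0"
    and "quad_char (1 - a) = quad_char (1 - b)" "quad_char (1 - a) \<noteq> 0"
  shows "medial (quad_qg a b) \<longleftrightarrow> a = b"
proof
  assume "medial (quad_qg a b)"
  then have "left_distributive (quad_qg a b)"
    using idempotent_quad_qg[of a b]
    unfolding medial_def left_distributive_def idempotent_op_def by metis
  then show "a = b" by (rule left_distributive_quad_qg_imp_eq[OF assms])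
next
  assume "a = b"
  then show "medial (quad_qg a b)" by (simp add: medial_def quad_qg_coef algebra_simps)
qed

section \<open>Isotopy to a group\<close>

text \<open>Besides cancellation, this is the quadrangle criterion: for left translations L, the map
  \<open>L_y o L_x^-1 o L_z\<close> is again a left translation \<open>L_w\<close>. In the group,
  \<open>w\<close> corresponds to \<alpha>(y) \<alpha>(x)^-1 \<alpha>(z).\<close>

lemma isotopic_to_group_conditions:
  assumes "isotopic_to_group f"
  shows "f x y = f x z \<Longrightarrow> y = z" and "f x z = f y z \<Longrightarrow> x = y"
    and "\<exists>w. \<forall>u v. f x v = f z u \<longrightarrow> f y v = f w u"
proof -
  from assms obtain G :: "'a monoid" and \<alpha> \<beta> \<gamma> where "Group.group G"
    and bij: "bij_betw \<alpha> UNIV (carrier G)" "bij_betw \<beta> UNIV (carrier G)" "bij_betw \<gamma> UNIV (carrier G)"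
    and eq: "\<And>x y. \<alpha> x \<otimes>\<^bsub>G\<^esub> \<beta> y = \<gamma> (f x y)"
    unfolding isotopic_to_group_def isotopic_to_def by blast
  interpret G: Group.group G by fact
  have carr [simp]: "\<alpha> x \<in> carrier G" "\<beta> x \<in> carrier G" for x
    using bij by (auto simp: bij_betw_def)
  have inj: "\<alpha> x = \<alpha> y \<Longrightarrow> x = y" "\<beta> x = \<beta> y \<Longrightarrow> x = y" "\<gamma> x = \<gamma> y \<Longrightarrow> x = y" for x y
    using bij[THEN bij_betw_imp_inj_on] by (meson UNIV_I inj_onD)+
  show "y = z" if "f x y = f x z"
    using eq[of x y] eq[of x z] that inj(2) by (metis G.Units_l_cancel G.Units_eq carr)
  show "x = y" if "f x z = f y z"
    using eq[of x z] eq[of y z] that inj(1) by (metis G.right_cancel carr)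
  have "\<alpha> y \<otimes>\<^bsub>G\<^esub> inv\<^bsub>G\<^esub> (\<alpha> x) \<otimes>\<^bsub>G\<^esub> \<alpha> z \<in> \<alpha> ` UNIV"
    using bij(1) by (simp add: bij_betw_def)
  then obtain w where w: "\<alpha> w = \<alpha> y \<otimes>\<^bsub>G\<^esub> inv\<^bsub>G\<^esub> (\<alpha> x) \<otimes>\<^bsub>G\<^esub> \<alpha> z" by auto
  have "f y v = f w u" if "f x v = f z u" for u v
  proof (rule inj(3))
    have "\<alpha> x \<otimes>\<^bsub>G\<^esub> \<beta> v = \<alpha> z \<otimes>\<^bsub>G\<^esub> \<beta> u" using that eq by simp
    then have "\<beta> v = inv\<^bsub>G\<^esub> (\<alpha> x) \<otimes>\<^bsub>G\<^esub> (\<alpha> z \<otimes>\<^bsub>G\<^esub> \<beta> u)"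
      by (metis G.inv_solve_left G.m_closed carr)
    then show "\<gamma> (f y v) = \<gamma> (f w u)"
      unfolding eq[symmetric] w by (simp add: G.m_assoc)
  qed
  then show "\<exists>w. \<forall>u v. f x v = f z u \<longrightarrow> f y v = f w u" by blast
qed

lemma isotopic_to_group_quad_qg_imp_additive:
  fixes a b :: "'a :: {field, finite}"
  assumes odd: "odd CARD('a)" and iso: "isotopic_to_group (quad_qg a b)"
  shows "quad_qg a b 0 (u + w) = quad_qg a b 0 u + quad_qg a b 0 w"
proof -
  define f where "f = quad_qg a b"
  note cond = isotopic_to_group_conditions[OF iso, folded f_def]
  have trans: "f (x + t) (y + t) = f x y + t" for x y t
    unfolding f_def by (rule quad_qg_translate)
  \<comment> \<open>These are the maps \<open>L_0^-1 o L_z\<close>, written without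
    inverses.\<close>
  define H where "H = {g. \<exists>z. \<forall>u. f 0 (g u) = f z u}"
  \<comment> \<open>By the quadrangle criterion the base point 0 in \<open>H\<close> may be replaced
    by any \<open>x\<close>. This yields closure under composition and, below, under conjugation by
    translations.\<close>
  have shift: "\<exists>w. \<forall>u. f x (g u) = f w u" if "g \<in> H" for g x
    using that cond(3)[of 0 _ x] unfolding H_def by blast
  have comp: "g \<circ> h \<in> H" if "g \<in> H" "h \<in> H" for g h
    using that(1) shift[OF that(2)] unfolding H_def by fastforce
  \<comment> \<open>Conjugation of \<open>g\<close> by the translation by \<open>t\<close>.\<close>
  define act where "act t g = (\<lambda>u. t + g (u - t))" for t and g :: "'a \<Rightarrow> 'a"
  have bij_0: "bij (f 0)"
    using cond(1) by (simp add: bij_def inj_def finite_UNIV_inj_surj)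
  \<comment> \<open>\<open>F\<close> parametrises \<open>H\<close> bijectively by the field, which
    gives the order of \<open>H\<close>.\<close>
  define F where "F z u = inv_into UNIV (f 0) (f z u)" for z u
  have F: "f 0 (F z u) = f z u" for z u
    unfolding F_def using bij_0 by (simp add: bij_is_surj f_inv_into_f)
  have F_in: "F z \<in> H" for z using F unfolding H_def by blast
  have H_eq: "H = range F"
  proof (intro equalityI subsetI)
    fix g assume "g \<in> H"
    then obtain z where "\<And>u. f 0 (g u) = f z u" unfolding H_def by blast
    then have "g = F z" using cond(1) F by (metis ext)
    then show "g \<in> range F" by blast
  qed (use F_in in blast)
  have "inj F" using F cond(2) by (metis injI)
  then have "card H = CARD('a)" unfolding H_eq by (rule card_image)
  have "\<exists>g\<in>H. g \<noteq> id \<and> (\<forall>t. act t g = g)"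
  proof (rule additive_action_fixed_point)
    show "CHAR('a) dvd card H" unfolding \<open>card H = CARD('a)\<close> by (rule CHAR_dvd_CARD)
    show "act t g \<in> H" if g: "g \<in> H" for t g
    proof -
      obtain z where z: "\<And>u. f (- t) (g u) = f z u" using shift[OF g] by blast
      have "f 0 (act t g u) = f (z + t) u" for u
        using trans[of "- t" t "g (u - t)"] trans[of z t "u - t"] z[of "u - t"]
        by (simp add: act_def add.commute)
      then show ?thesis unfolding H_def by blast
    qed
    show "act (s + t) g = act s (act t g)" for s t g
      by (simp add: act_def fun_eq_iff algebra_simps)
    show "id \<in> H" unfolding H_def by auto
  qed (simp_all add: act_def fun_eq_iff)
  then obtain g where g: "g \<in> H" "g \<noteq> id" "\<And>t. act t g = g" by blast
  define D where "D = {t. (\<lambda>u. u + t) \<in> H}"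
  define t where "t = g 0"
  have g_eq: "g = (\<lambda>u. u + t)"
  proof
    \<comment> \<open>Evaluating \<open>act u g = g\<close> at \<open>u\<close> itself gives
      \<open>u + g 0 = g u\<close>.\<close>
    fix u show "g u = u + t" using fun_cong[OF g(3)[of u], of u] by (simp add: act_def t_def)
  qed
  have "t \<noteq> 0" using g(2) by (auto simp: g_eq fun_eq_iff)
  have D_add: "x + y \<in> D" if "x \<in> D" "y \<in> D" for x y
    using comp[of "\<lambda>u. u + y" "\<lambda>u. u + x"] that by (simp add: D_def o_def add.assoc)
  have D_scale: "s\<^sup>2 * x \<in> D" if "x \<in> D" for s x
  proof (cases "s = 0")
    case True
    then show ?thesis unfolding D_def H_def by auto
  next
    case False
    from that obtain z where z: "\<And>u. f 0 (u + x) = f z u" unfolding D_def H_def by blast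
    have "f 0 (u + s\<^sup>2 * x) = f (s\<^sup>2 * z) u" for u
      using quad_qg_scale[OF False, of a b 0 "u / s\<^sup>2 + x"] quad_qg_scale[OF False, of a b z "u / s\<^sup>2"]
        z[of "u / s\<^sup>2"] False by (simp add: f_def distrib_left)
    then show ?thesis unfolding D_def H_def by blast
  qed
  have "(\<lambda>y. y * t) ` {y. quad_char y \<ge> 0} \<subseteq> D"
  proof (intro image_subsetI)
    fix y :: 'a assume "y \<in> {y. quad_char y \<ge> 0}"
    then obtain s where "y = s\<^sup>2" by (auto simp: quad_char_def split: if_splits)
    then show "y * t \<in> D" using D_scale[of t s] g(1) by (simp add: D_def g_eq)
  qed
  then have "card ((\<lambda>y. y * t) ` {y. quad_char y \<ge> 0}) \<le> card D" by (intro card_mono) simp_all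
  moreover have "card ((\<lambda>y. y * t) ` {y. quad_char y \<ge> 0}) = card {y :: 'a. quad_char y \<ge> 0}"
    using \<open>t \<noteq> 0\<close> by (intro card_image) (simp add: inj_on_def)
  ultimately have majority: "CARD('a) < 2 * card D" using card_quad_char_ge_0[OF odd] by simp
  have D_UNIV: "d \<in> D" for d
    by (rule sum_of_two_from_majority[OF majority, of d]) (use D_add in simp)
  \<comment> \<open>As \<open>L_0^-1 o L_z\<close> is a translation, it is the one by
    \<open>d\<close>, its value at 0. Translating by \<open>z\<close> then gives
    \<open>f 0 (u + z + d) = f 0 u + z\<close>, and \<open>u = 0\<close> identifies
    \<open>z + d\<close> with \<open>w\<close>.\<close>
  define z where "z = f 0 w"
  define d where "d = F z 0"
  obtain z' where z': "\<And>u. f 0 (u + d) = f z' u" using D_UNIV[of d] unfolding D_def H_def by blast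
  have "z' = z" using z'[of 0] F[of z 0] cond(2)[of z' 0 z] by (simp add: d_def)
  then have "f 0 (u + z + d) = f z (u + z)" for u using z'[of "u + z"] by (simp add: add.assoc)
  moreover have "f z (u + z) = f 0 u + z" for u using trans[of 0 z u] by simp
  ultimately have *: "f 0 (u + z + d) = f 0 u + z" for u by simp
  have "f 0 0 = 0" by (simp add: f_def quad_qg_def)
  then have "w = z + d" using *[of 0] cond(1)[of 0 w "z + d"] by (simp add: z_def)
  then show ?thesis using *[of u] by (simp add: f_def z_def add.assoc)
qed

text \<open>A nonsquare \<open>n\<close> is a sum of two elements on which the left translation by 0
  multiplies by \<open>a\<close>; additivity gives \<open>a * n\<close>, the definition
  \<open>b * n\<close>. Conversely, \<open>a = b\<close> makes the operation
  \<open>(1 - a) * x + a * y\<close>.\<close>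

lemma isotopic_to_group_quad_qg_iff:
  fixes a b :: "'a :: {field, finite}"
  assumes odd: "odd CARD('a)" and nz: "a \<noteq> 0" "a \<noteq> 1"
  shows "isotopic_to_group (quad_qg a b) \<longleftrightarrow> a = b"
proof
  assume iso: "isotopic_to_group (quad_qg a b)"
  obtain n :: 'a where n: "quad_char n = - 1" using exists_nonsquare[OF odd] by blast
  have "CARD('a) < 2 * card {x :: 'a. quad_char x \<ge> 0}" using card_quad_char_ge_0[OF odd] by simp
  then obtain x y where "quad_char x \<ge> 0" "quad_char y \<ge> 0" "n = x + y"
    by (rule sum_of_two_from_majority[of _ n]) simp
  then have "quad_qg a b 0 n = a * n"
    using isotopic_to_group_quad_qg_imp_additive[OF odd iso, of x y]
    by (simp add: quad_qg_def distrib_left)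
  moreover have "quad_qg a b 0 n = b * n" using n by (simp add: quad_qg_def)
  moreover have "n \<noteq> 0" using n by auto
  ultimately show "a = b" by simp
next
  assume "a = b"
  let ?G = "additive_group :: 'a monoid"
  have "Group.group ?G" by (rule group_additive_group)
  moreover have "isotopic_to (quad_qg a b) ?G"
    unfolding isotopic_to_def
  proof (intro exI conjI allI)
    have bij: "bij ((*) c)" if "c \<noteq> 0" for c :: 'a
      using that by (simp add: bij_def inj_def finite_UNIV_inj_surj)
    show "bij_betw ((*) (1 - a)) UNIV (carrier ?G)" "bij_betw ((*) a) UNIV (carrier ?G)"
      using bij nz by (simp_all add: additive_group_def)
    show "bij_betw id UNIV (carrier ?G)" by (simp add: additive_group_def)
    show "((1 - a) * x) \<otimes>\<^bsub>?G\<^esub> (a * y) = id (quad_qg a b x y)" for x y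
      using \<open>a = b\<close> by (simp add: additive_group_def quad_qg_def algebra_simps)
  qed
  ultimately show "isotopic_to_group (quad_qg a b)" unfolding isotopic_to_group_def by blast
qed

section \<open>Commutativity, flexibility and semisymmetry\<close>

text \<open>The law equates the operation with its opposite. If -1 is a square, testing 0 against 1
  and against a nonsquare gives \<open>2 * a = 1 = 2 * b\<close>; otherwise the coefficients change
  places and 0 against 1 suffices.\<close>

lemma commutative_quad_qg_iff:
  fixes a b :: "'a :: {field, finite}"
  assumes odd: "odd CARD('a)"
  shows "commutative_op (quad_qg a b) \<longleftrightarrow> a + b = 1 \<and> (quad_char (- 1 :: 'a) = - 1 \<or> a = b)"
proof -
  consider "quad_char (- 1 :: 'a) = 1" | "quad_char (- 1 :: 'a) = - 1"
    using quad_char_nonzero[of "- 1 :: 'a"] by auto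
  then show ?thesis
  proof cases
    case 1
    have "a + a = 1 \<and> b + b = 1" if "commutative_op (quad_qg a b)"
    proof -
      obtain n :: 'a where n: "quad_char n = - 1" using exists_nonsquare[OF odd] by blast
      moreover have "quad_char (- n) = - 1"
        using 1 n quad_char_mult[OF odd, of "- 1" n] by simp
      moreover have "quad_qg a b 0 1 = quad_qg a b 1 0" "quad_qg a b 0 n = quad_qg a b n 0"
        using that unfolding commutative_op_def by blast+
      ultimately have "a = 1 - a" "b * n = n - b * n" using 1 by (simp_all add: quad_qg_coef)
      then have "a + a = 1" "(b + b) * n = 1 * n" by (simp_all add: algebra_simps)
      moreover have "n \<noteq> 0" using n by auto
      ultimately show ?thesis by simp
    qed
    moreover have "a = b" if "a + a = 1" "b + b = 1"
    proof -
      have "2 * a = 2 * b" using that by (simp only: mult_2)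
      then show ?thesis using two_neq_zero[OF odd] by simp
    qed
    moreover have "commutative_op (quad_qg a b)" if "a + b = 1" "a = b"
    proof -
      have "1 - a = a" "1 - b = b" using that by (auto simp: diff_eq_eq)
      then show ?thesis
        using quad_qg_opposite(1)[OF odd 1, of a b] unfolding commutative_op_def by metis
    qed
    ultimately show ?thesis using 1 by auto
  next
    case 2
    have "a + b = 1" if "commutative_op (quad_qg a b)"
    proof -
      have "quad_qg a b 0 1 = quad_qg a b 1 0"
        using that unfolding commutative_op_def by blast
      then have "a = 1 - b" using 2 by (simp add: quad_qg_coef)
      then show ?thesis by simp
    qed
    moreover have "commutative_op (quad_qg a b)" if "a + b = 1"
    proof -
      have "1 - b = a" "1 - a = b" using that by (auto simp: diff_eq_eq add.commute)
      then show ?thesis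
        using quad_qg_opposite(2)[OF odd 2, of a b] unfolding commutative_op_def by metis
    qed
    ultimately show ?thesis using 2 by auto
  qed
qed

lemma quad_qg_0_left: "quad_qg a b 0 y = coef a b (quad_char y) * y"
  by (simp add: quad_qg_coef)

lemma quad_qg_0_right:
  fixes a b y :: "'a :: {field, finite}"
  assumes "odd CARD('a)"
  shows "quad_qg a b y 0 = (1 - coef a b (quad_char (- 1 :: 'a) * quad_char y)) * y"
  using quad_char_mult[OF assms, of "- 1" y] by (simp add: quad_qg_coef algebra_simps)

text \<open>Multiplying by 0 on the left changes the character by that of \<open>a\<close>, on the
  right by that of \<open>1 - a\<close>, whichever coefficient is used; so both sides depend on
  \<open>y\<close> only through its sign. The first identity also serves semisymmetry.\<close>

lemma quad_qg_flexible_sides: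
  fixes a b y :: "'a :: {field, finite}"
  assumes odd: "odd CARD('a)" and ab: "quad_char a = quad_char b"
    and ab': "quad_char (1 - a) = quad_char (1 - b)"
  defines "\<epsilon> \<equiv> quad_char (- 1 :: 'a)"
  shows "quad_qg a b (quad_qg a b 0 y) 0 =
      coef a b (quad_char y) * (1 - coef a b (\<epsilon> * quad_char a * quad_char y)) * y"
    and "quad_qg a b 0 (quad_qg a b y 0) =
      coef a b (quad_char (1 - a) * quad_char y) * (1 - coef a b (\<epsilon> * quad_char y)) * y"
proof -
  have "quad_char (coef a b \<sigma> * y) = quad_char a * quad_char y" for \<sigma>
    using ab by (simp add: coef_def quad_char_mult[OF odd])
  then show "quad_qg a b (quad_qg a b 0 y) 0 =
      coef a b (quad_char y) * (1 - coef a b (\<epsilon> * quad_char a * quad_char y)) * y"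
    unfolding quad_qg_0_left quad_qg_0_right[OF odd] \<epsilon>_def by (simp add: mult_ac)
  have "quad_char ((1 - coef a b \<sigma>) * y) = quad_char (1 - a) * quad_char y" for \<sigma>
    using ab' by (simp add: coef_def quad_char_mult[OF odd])
  then show "quad_qg a b 0 (quad_qg a b y 0) =
      coef a b (quad_char (1 - a) * quad_char y) * (1 - coef a b (\<epsilon> * quad_char y)) * y"
    unfolding quad_qg_0_left quad_qg_0_right[OF odd] \<epsilon>_def by (simp add: mult_ac)
qed

text \<open>Turns an identity in \<open>y\<close> into two equations, tested at 1 and at a
  nonsquare; at \<open>y = 0\<close> it is trivial.\<close>

lemma all_multiples_by_quad_char_eq_iff:
  fixes P Q :: "int \<Rightarrow> 'a :: {field, finite}"
  assumes "odd CARD('a)"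
  shows "(\<forall>y. P (quad_char y) * y = Q (quad_char y) * y) \<longleftrightarrow> P 1 = Q 1 \<and> P (- 1) = Q (- 1)"
proof
  assume *: "\<forall>y. P (quad_char y) * y = Q (quad_char y) * y"
  obtain n :: 'a where n: "quad_char n = - 1" using exists_nonsquare[OF assms] by blast
  moreover have "n \<noteq> 0" using n by auto
  ultimately show "P 1 = Q 1 \<and> P (- 1) = Q (- 1)"
    using *[rule_format, of 1] *[rule_format, of n] by simp
next
  assume *: "P 1 = Q 1 \<and> P (- 1) = Q (- 1)"
  show "\<forall>y. P (quad_char y) * y = Q (quad_char y) * y"
  proof
    fix y
    show "P (quad_char y) * y = Q (quad_char y) * y"
      using * quad_char_nonzero[of y] by (cases "y = 0") auto
  qed
qed

lemma flexible_quad_qg_iff: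
  fixes a b :: "'a :: {field, finite}"
  assumes odd: "odd CARD('a)"
    and ab: "quad_char a = quad_char b" "quad_char a \<noteq> 0"
      "quad_char (1 - a) = quad_char (1 - b)" "quad_char (1 - a) \<noteq> 0"
  shows "flexible (quad_qg a b) \<longleftrightarrow> a = b \<or> (quad_char a = 1 \<and> quad_char (1 - a) = 1)
    \<or> (a + b = 1 \<and> quad_char (- 1 :: 'a) = - 1)"
proof -
  define \<epsilon> \<eta> \<theta> where "\<epsilon> = quad_char (- 1 :: 'a)" and "\<eta> = quad_char a" and "\<theta> = quad_char (1 - a)"
  have nz: "a \<noteq> 0" "b \<noteq> 0" "a \<noteq> 1" "b \<noteq> 1" using ab by auto
  have signs: "\<epsilon> = 1 \<or> \<epsilon> = - 1" "\<eta> = 1 \<or> \<eta> = - 1" "\<theta> = 1 \<or> \<theta> = - 1"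
    using quad_char_nonzero[of "- 1 :: 'a"] quad_char_nonzero[of a] quad_char_nonzero[of "1 - a"] nz
    by (simp_all add: \<epsilon>_def \<eta>_def \<theta>_def)
  have "flexible (quad_qg a b) \<longleftrightarrow>
    (\<forall>y. quad_qg a b 0 (quad_qg a b y 0) = quad_qg a b (quad_qg a b 0 y) 0)"
  proof
    assume *: "\<forall>y. quad_qg a b 0 (quad_qg a b y 0) = quad_qg a b (quad_qg a b 0 y) 0"
    have "quad_qg a b x (quad_qg a b y x) = quad_qg a b (quad_qg a b x y) x" for x y
      using *[rule_format, of "y - x"] quad_qg_translate[of a b 0 x "y - x"]
        quad_qg_translate[of a b "y - x" x 0]
        quad_qg_translate[of a b 0 x "quad_qg a b (y - x) 0"]
        quad_qg_translate[of a b "quad_qg a b 0 (y - x)" x 0] by simp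
    then show "flexible (quad_qg a b)" by (simp add: flexible_def)
  qed (simp add: flexible_def)
  also have "\<dots> \<longleftrightarrow>
    coef a b \<theta> * (1 - coef a b \<epsilon>) = a * (1 - coef a b (\<epsilon> * \<eta>)) \<and>
    coef a b (- \<theta>) * (1 - coef a b (- \<epsilon>)) = b * (1 - coef a b (- (\<epsilon> * \<eta>)))"
    unfolding quad_qg_flexible_sides[OF odd ab(1,3)]
    by (subst all_multiples_by_quad_char_eq_iff[OF odd]) (simp add: \<epsilon>_def \<eta>_def \<theta>_def)
  also have "\<dots> \<longleftrightarrow> a = b \<or> (\<eta> = 1 \<and> \<theta> = 1) \<or> (a + b = 1 \<and> \<epsilon> = - 1)"
  proof -
    \<comment> \<open>Needed when \<open>a + b = 1\<close> and -1 is a nonsquare: it rules out the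
      mixed signs, whose equations would force \<open>a = b\<close>.\<close>
    have sub: "\<eta> = \<theta>" if "a + b = 1"
    proof -
      have "1 - a = b" using that by (auto simp: diff_eq_eq add.commute)
      then show ?thesis using ab(1) by (simp add: \<eta>_def \<theta>_def)
    qed
    have cross: "a * (1 - b) = b * (1 - a) \<longleftrightarrow> a = b" "b * (1 - a) = a * (1 - b) \<longleftrightarrow> a = b"
      by (auto simp: algebra_simps)
    have "a * (1 - a) - b * (1 - b) = (a - b) * (1 - (a + b))" by (simp add: algebra_simps)
    then have straight: "a * (1 - a) = b * (1 - b) \<longleftrightarrow> a = b \<or> a + b = 1"
      "b * (1 - b) = a * (1 - a) \<longleftrightarrow> a = b \<or> a + b = 1"
      by (metis eq_iff_diff_eq_0 mult_eq_0_iff)+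
    show ?thesis using signs nz sub by (elim disjE) (auto simp: cross straight)
  qed
  finally show ?thesis by (simp add: \<epsilon>_def \<eta>_def \<theta>_def)
qed

lemma semisymmetric_quad_qg_iff:
  fixes a b :: "'a :: {field, finite}"
  assumes odd: "odd CARD('a)"
    and ab: "quad_char a = quad_char b" "quad_char a \<noteq> 0"
      "quad_char (1 - a) = quad_char (1 - b)"
  shows "semisymmetric (quad_qg a b) \<longleftrightarrow> a\<^sup>2 - a + 1 = 0 \<and> (a = b \<or> a + b = 1)"
proof -
  define \<epsilon> where "\<epsilon> = quad_char (- 1 :: 'a)"
  have "semisymmetric (quad_qg a b) \<longleftrightarrow> (\<forall>y. quad_qg a b (quad_qg a b 0 y) 0 = y)"
  proof
    assume *: "\<forall>y. quad_qg a b (quad_qg a b 0 y) 0 = y"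
    have "quad_qg a b (quad_qg a b x y) x = y" for x y
      using *[rule_format, of "y - x"] quad_qg_translate[of a b 0 x "y - x"]
        quad_qg_translate[of a b "quad_qg a b 0 (y - x)" x 0] by simp
    then show "semisymmetric (quad_qg a b)" by (simp add: semisymmetric_def)
  qed (simp add: semisymmetric_def)
  also have "\<dots> \<longleftrightarrow> a * (1 - coef a b (\<epsilon> * quad_char a)) = 1 \<and>
      b * (1 - coef a b (- (\<epsilon> * quad_char a))) = 1"
    unfolding quad_qg_flexible_sides[OF odd ab(1,3)]
    using all_multiples_by_quad_char_eq_iff[OF odd,
        of "\<lambda>\<sigma>. coef a b \<sigma> * (1 - coef a b (\<epsilon> * quad_char a * \<sigma>))" "\<lambda>_. 1"]
    by (simp add: \<epsilon>_def)
  also have "\<dots> \<longleftrightarrow> a\<^sup>2 - a + 1 = 0 \<and> (a = b \<or> a + b = 1)"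
  proof -
    have poly: "c * (1 - c) = 1 \<longleftrightarrow> c\<^sup>2 - c + 1 = 0" for c :: 'a
    proof -
      have "c\<^sup>2 - c + 1 = 1 - c * (1 - c)" by (simp add: power2_eq_square algebra_simps)
      then show ?thesis by auto
    qed
    have char_mult: "\<epsilon> * quad_char a = quad_char (- b)"
      using quad_char_mult[OF odd, of "- 1" b] ab by (simp add: \<epsilon>_def)
    have "b \<noteq> 0" using ab by auto
    then consider "\<epsilon> * quad_char a = 1" | "\<epsilon> * quad_char a = - 1"
      unfolding char_mult using quad_char_nonzero[of "- b"] by auto
    \<comment> \<open>If \<open>- b\<close> is a square, \<open>a\<close> and \<open>b\<close> are
      both roots of X^2 - X + 1, whose roots sum to 1. Otherwise the equations are crossed and their
      difference gives \<open>a = b\<close>.\<close>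
    then show ?thesis
    proof cases
      case 1
      have "b\<^sup>2 - b + 1 = (a\<^sup>2 - a + 1) + (a - b) * (1 - (a + b))"
        by (simp add: power2_eq_square algebra_simps)
      then have "b\<^sup>2 - b + 1 = 0 \<longleftrightarrow> a = b \<or> a + b = 1" if "a\<^sup>2 - a + 1 = 0"
        using that by auto
      then show ?thesis using 1 by (auto simp: poly)
    next
      case 2
      \<comment> \<open>Holds vacuously: these equations make \<open>- b\<close> the square of
        \<open>a\<close>, against the case assumption.\<close>
      have "a = b" if "a\<^sup>2 - a + 1 = 0" "a + b = 1"
      proof -
        have "- b = a\<^sup>2 - (a\<^sup>2 - a + 1) + (1 - (a + b))" by simp
        then have "- b = a\<^sup>2" using that by simp
        moreover have "a \<noteq> 0" using ab by auto
        ultimately show ?thesis using 2 char_mult by simp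
      qed
      moreover have "a = b" if "a * (1 - b) = 1" "b * (1 - a) = 1"
      proof -
        have "a - b = a * (1 - b) - b * (1 - a)" by (simp add: algebra_simps)
        then show ?thesis using that by simp
      qed
      ultimately show ?thesis using 2 poly by auto
    qed
  qed
  finally show ?thesis .
qed

section \<open>Steiner quasigroups\<close>

lemma sum_and_product_one_imp_neq:
  fixes a b :: "'a :: field"
  assumes "CHAR('a) > 3" "a + b = 1" "a * b = 1"
  shows "a \<noteq> b"
proof
  assume "a = b"
  then have "2 * a = 1" "a * a = 1" using assms by auto
  \<comment> \<open>The two relations for \<open>a\<close> are combined to give 4 = 1, so the
    characteristic divides 3.\<close>
  moreover have "4 * (a * a) = (2 * a) * (2 * a)" by simp
  ultimately have "(4 :: 'a) = 1" by (simp only: mult_1_right)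
  moreover have "(3 :: 'a) = 4 - 1" by simp
  ultimately have "(3 :: 'a) = 0" by simp
  then have "CHAR('a) dvd 3" by (metis of_nat_eq_0_iff_char_dvd of_nat_numeral)
  then show False using assms(1) by (auto dest: dvd_imp_le)
qed

text \<open>Commutativity and semisymmetry make \<open>a\<close> and \<open>b = 1 - a\<close> the
  roots of X^2 - X + 1. In characteristic 3 this is (X + 1)^2. In larger characteristic the roots
  differ, so commutativity forces -1 to be a nonsquare, and \<open>- b\<close> being the square of
  \<open>a\<close> then makes \<open>b\<close> one too.\<close>

lemma steiner_quad_qg_iff:
  fixes a b :: "'a :: {field, finite}"
  assumes odd: "odd CARD('a)"
    and ab: "quad_char a = quad_char b" "quad_char a \<noteq> 0"
      "quad_char (1 - a) = quad_char (1 - b)"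
  shows "steiner_quasigroup (quad_qg a b) \<longleftrightarrow>
    (CHAR('a) = 3 \<and> a = - 1 \<and> b = - 1)
    \<or> (CHAR('a) > 3 \<and> a + b = 1 \<and> a * b = 1
        \<and> quad_char a = - 1 \<and> quad_char (- 1 :: 'a) = - 1)"
    (is "_ \<longleftrightarrow> ?small \<or> ?large")
proof -
  have char3: "(3 :: 'a) = 0" if "CHAR('a) = 3"
    using of_nat_CHAR[where 'a = 'a] that by simp
  have "steiner_quasigroup (quad_qg a b) \<longleftrightarrow>
      a + b = 1 \<and> (quad_char (- 1 :: 'a) = - 1 \<or> a = b) \<and> a\<^sup>2 - a + 1 = 0"
    unfolding steiner_quasigroup_def commutative_quad_qg_iff[OF odd]
      semisymmetric_quad_qg_iff[OF odd ab]
    using idempotent_quad_qg[of a b] by blast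
  also have "\<dots> \<longleftrightarrow> ?small \<or> ?large"
  proof
    assume *: "a + b = 1 \<and> (quad_char (- 1 :: 'a) = - 1 \<or> a = b) \<and> a\<^sup>2 - a + 1 = 0"
    have b: "b = 1 - a" using * by (auto simp: eq_diff_eq add.commute)
    show "?small \<or> ?large"
    proof (cases "CHAR('a) = 3")
      case True
      have "(a + 1)\<^sup>2 = (a\<^sup>2 - a + 1) + 3 * a" by (simp add: power2_eq_square algebra_simps)
      then have "a + 1 = 0" using * char3[OF True] by simp
      then have "a = - 1" by (simp add: eq_neg_iff_add_eq_0)
      moreover have "b = 3 - 1" using b \<open>a = - 1\<close> by simp
      then have "b = - 1" using char3[OF True] by simp
      ultimately show ?thesis using True by simp
    next
      case False
      have "CHAR('a) \<noteq> 2"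
        using of_nat_CHAR[where 'a = 'a] two_neq_zero[OF odd] by (metis of_nat_numeral)
      moreover have "CHAR('a) > 0" by (rule finite_imp_CHAR_pos) simp
      moreover have "CHAR('a) \<noteq> 1" by simp
      ultimately have "CHAR('a) > 3" using False by linarith
      moreover have "a * b = 1 - (a\<^sup>2 - a + 1)"
        unfolding b by (simp add: power2_eq_square algebra_simps)
      then have "a * b = 1" using * by simp
      ultimately have "a \<noteq> b" using * sum_and_product_one_imp_neq[of a b] by blast
      then have minus: "quad_char (- 1 :: 'a) = - 1" using * by blast
      have "- b = a\<^sup>2 - (a\<^sup>2 - a + 1)" unfolding b by simp
      then have "- b = a\<^sup>2" using * by simp
      moreover have "a \<noteq> 0" using ab by auto
      ultimately have "quad_char (- b) = 1" by simp
      then have "quad_char b = - 1"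
        using quad_char_mult[OF odd, of "- 1" b] minus by simp
      then show ?thesis
        using \<open>CHAR('a) > 3\<close> \<open>a * b = 1\<close> minus * ab by simp
    qed
  next
    assume "?small \<or> ?large"
    then show "a + b = 1 \<and> (quad_char (- 1 :: 'a) = - 1 \<or> a = b) \<and> a\<^sup>2 - a + 1 = 0"
    proof
      assume small: ?small
      have "a + b = 1 - 3" "a\<^sup>2 - a + 1 = 3" using small by simp_all
      then show ?thesis using small char3 by simp
    next
      assume large: ?large
      then have b: "b = 1 - a" by (auto simp: eq_diff_eq add.commute)
      have "a\<^sup>2 - a + 1 = 1 - a * b" unfolding b by (simp add: power2_eq_square algebra_simps)
      then show ?thesis using large by simp
    qed
  qed
  finally show ?thesis .
qed

theorem theorem1p3:
  fixes a b :: "'a :: {field, finite}"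
  assumes odd_order: "odd CARD('a)"
    and "quad_char a = quad_char b" and "quad_char a \<noteq> 0"
    and "quad_char (1 - a) = quad_char (1 - b)" and "quad_char (1 - a) \<noteq> 0"
  shows "(medial (quad_qg a b) \<longleftrightarrow> a = b)
    \<and> (left_distributive (quad_qg a b) \<longleftrightarrow> a = b)
    \<and> (right_distributive (quad_qg a b) \<longleftrightarrow> a = b)
    \<and> (commutative_op (quad_qg a b) \<longleftrightarrow> a + b = 1 \<and> ([CARD('a) = 3] (mod 4) \<or> a = b))
    \<and> (flexible (quad_qg a b) \<longleftrightarrow>
         a = b \<or> (quad_char a = 1 \<and> quad_char (1 - a) = 1)
         \<or> (a + b = 1 \<and> [CARD('a) = 3] (mod 4)))
    \<and> (semisymmetric (quad_qg a b) \<longleftrightarrow> a ^ 2 - a + 1 = 0 \<and> (a = b \<or> a + b = 1))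
    \<and> (steiner_quasigroup (quad_qg a b) \<longleftrightarrow>
         (CHAR('a) = 3 \<and> a = - 1 \<and> b = - 1)
         \<or> (CHAR('a) > 3 \<and> a + b = 1 \<and> a * b = 1
             \<and> quad_char a = - 1 \<and> quad_char (- 1 :: 'a) = - 1))
    \<and> (CHAR('a) > 3 \<and> a + b = 1 \<and> a * b = 1
         \<and> quad_char a = - 1 \<and> quad_char (- 1 :: 'a) = - 1 \<longrightarrow> a \<noteq> b)
    \<and> (isotopic_to_group (quad_qg a b) \<longleftrightarrow> a = b)"
proof (intro conjI impI)
  note ab = assms(2-5)
  have nz: "a \<noteq> 0" "a \<noteq> 1" using ab by auto
  show "medial (quad_qg a b) \<longleftrightarrow> a = b" by (rule medial_quad_qg_iff[OF odd_order ab])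
  show "left_distributive (quad_qg a b) \<longleftrightarrow> a = b"
    by (rule left_distributive_quad_qg_iff[OF odd_order ab])
  show "right_distributive (quad_qg a b) \<longleftrightarrow> a = b"
    by (rule right_distributive_quad_qg_iff[OF odd_order ab])
  show "commutative_op (quad_qg a b) \<longleftrightarrow> a + b = 1 \<and> ([CARD('a) = 3] (mod 4) \<or> a = b)"
    unfolding quad_char_minus_1_iff[OF odd_order, symmetric]
    by (rule commutative_quad_qg_iff[OF odd_order])
  show "flexible (quad_qg a b) \<longleftrightarrow> a = b \<or> (quad_char a = 1 \<and> quad_char (1 - a) = 1)
      \<or> (a + b = 1 \<and> [CARD('a) = 3] (mod 4))"
    unfolding quad_char_minus_1_iff[OF odd_order, symmetric]
    by (rule flexible_quad_qg_iff[OF odd_order ab])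
  show "semisymmetric (quad_qg a b) \<longleftrightarrow> a ^ 2 - a + 1 = 0 \<and> (a = b \<or> a + b = 1)"
    by (rule semisymmetric_quad_qg_iff[OF odd_order ab(1-3)])
  show "steiner_quasigroup (quad_qg a b) \<longleftrightarrow>
      (CHAR('a) = 3 \<and> a = - 1 \<and> b = - 1)
      \<or> (CHAR('a) > 3 \<and> a + b = 1 \<and> a * b = 1
          \<and> quad_char a = - 1 \<and> quad_char (- 1 :: 'a) = - 1)"
    by (rule steiner_quad_qg_iff[OF odd_order ab(1-3)])
  show "a \<noteq> b" if "CHAR('a) > 3 \<and> a + b = 1 \<and> a * b = 1
      \<and> quad_char a = - 1 \<and> quad_char (- 1 :: 'a) = - 1"
    using that sum_and_product_one_imp_neq[of a b] by blast
  show "isotopic_to_group (quad_qg a b) \<longleftrightarrow> a = b"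
    by (rule isotopic_to_group_quad_qg_iff[OF odd_order nz])
qed

end
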